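(* Let $X$ be a real (pre)-ordered Banach space, (pre)-ordered by a closed generating, not necessarily proper, cone $X^{+}$, and let $\alpha>0$. Then the following are equivalent: (1) $X$ is approximately $\alpha$-conormal; (2) For every $\varepsilon>0$, there exist continuous positively homogeneous maps $\gamma_{\varepsilon}^{+},\gamma_{\varepsilon}^{-}:X\to X^{+}$ such that: (a) $x=\gamma_{\varepsilon}^{+}(x)-\gamma_{\varepsilon}^{-}(x)$ for all $x\in X$; (b) $\|\gamma_{\varepsilon}^{+}(x)\|\leq(\alpha+\varepsilon)\|x\|$ for all $x\in X$.
   Context: A subset $C$ of a real vector space is a cone if $C+C\subseteq C$ and $\lambda C\subseteq C$ for all $\lambda\geq 0$; it is proper if $C\cap(-C)=\{0\}$ (not assumed here). The cone $X^+$ determines the (pre)-order on $X$, and is generating if $X=X^{+}-X^{+}$. For $\alpha>0$, a real (pre)-ordered normed space $X$ with closed generating, not necessarily proper, cone $X^+$ is called $\alpha$-conormal if, for each $x\in X$, there exist $x^{+},x^{-}\in X^{+}$ such that $x=x^{+}-x^{-}$ and $\|x^{+}\|\leq\alpha\|x\|$; it is called approximately $\alpha$-conormal if it is $(\alpha+\varepsilon)$-conormal for all $\varepsilon>0$. A map $\gamma:X\to X^+$ is positively homogeneous if $\gamma(\lambda x)=\lambda\gamma(x)$ for all $x\in X$ and $\lambda\geq0$. *)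

theory Defs
  imports "HOL-Analysis.Analysis"
begin

text \<open>
  The library predicate \<open>cone\<close> only asks for closure under nonnegative scaling, hence the separate
  notion below, which also asks for closure under addition. Like the usual textbook condition, it
  does not by itself exclude the empty set, but a generating set is never empty.
  The preorder is represented by its cone of positive elements.
\<close>

definition order_cone :: "'a::real_vector set \<Rightarrow> bool" where
  "order_cone C \<longleftrightarrow>
     {x + y | x y. x \<in> C \<and> y \<in> C} \<subseteq> C \<and> (\<forall>c\<ge>0. (\<lambda>x. c *\<^sub>R x) ` C \<subseteq> C)"

definition generating :: "'a::real_vector set \<Rightarrow> bool" where
  "generating C \<longleftrightarrow> UNIV = {x - y | x y. x \<in> C \<and> y \<in> C}"

text \<open>
  Conormality is meant for closed generating cones and \<open>\<alpha> > 0\<close>; these standing assumptions are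
  stated where it is used and are not part of the predicate.
\<close>

definition conormal :: "real \<Rightarrow> 'a::real_normed_vector set \<Rightarrow> bool" where
  "conormal \<alpha> C \<longleftrightarrow>
     (\<forall>x. \<exists>xp\<in>C. \<exists>xm\<in>C. x = xp - xm \<and> norm xp \<le> \<alpha> * norm x)"

definition approximately_conormal :: "real \<Rightarrow> 'a::real_normed_vector set \<Rightarrow> bool" where
  "approximately_conormal \<alpha> C \<longleftrightarrow> (\<forall>\<epsilon>>0. conormal (\<alpha> + \<epsilon>) C)"

definition positively_homogeneous :: "('a::real_vector \<Rightarrow> 'b::real_vector) \<Rightarrow> bool" where
  "positively_homogeneous \<gamma> \<longleftrightarrow> (\<forall>x. \<forall>c\<ge>0. \<gamma> (c *\<^sub>R x) = c *\<^sub>R \<gamma> x)"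

end

theory Submission
  imports Defs
begin

text \<open>
  Maps as on the right-hand side provide the decompositions required for approximate conormality
  point by point, so the content is to replace arbitrary choices by continuous, positively
  homogeneous ones.

  Fix \<open>a > \<alpha>\<close> and choose, for every unit vector \<open>x\<close>, a decomposition \<open>x = u x - v x\<close>
  with \<open>u x, v x\<close> in the cone \<open>C\<close> and \<open>norm (u x) \<le> a\<close>. Averaging the choices made near \<open>x\<close> with
  continuous weights (lemma \<open>approximate_continuous_selection\<close>) and extending radially gives
  continuous positively homogeneous maps \<open>G, H\<close> into \<open>C\<close>. These obey the same norm bounds, since
  \<open>C\<close> and the balls are closed and convex, but they decompose \<open>x\<close> only up to a remainder
  \<open>R x = x - G x + H x\<close> with \<open>norm (R x) \<le> \<delta> * norm x\<close>, where \<open>\<delta>\<close> is as small as desired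
  (lemma \<open>approximate_continuous_decomposition\<close>).

  The remainder is decomposed in turn by the same \<open>G\<close> and \<open>H\<close>. Summing,
  \<open>\<gamma>\<^sup>+ x = (\<Sum>n. G ((R ^^ n) x))\<close> and \<open>\<gamma>\<^sup>- x = (\<Sum>n. H ((R ^^ n) x))\<close>, the difference telescopes to \<open>x\<close>, because \<open>G y - H y = y - R y\<close> and \<open>(R ^^ n) x\<close> tends to \<open>0\<close>.
  The series converge geometrically, uniformly on the unit sphere, so the limits are continuous and
  positively homogeneous (lemma \<open>iterated_series\<close>), they lie in \<open>C\<close> because \<open>C\<close> is closed, and
  \<open>norm (\<gamma>\<^sup>+ x) \<le> a / (1 - \<delta>) * norm x\<close>. With \<open>a\<close> close enough to \<open>\<alpha>\<close> and a
  suitable small \<open>\<delta>\<close> the constant is \<open>\<alpha> + \<epsilon>\<close>.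
\<close>

section \<open>Approximate continuous selections on metric spaces\<close>

text \<open>
  This takes the place of paracompactness of metric spaces: \<open>V n\<close> is the union of a family of open
  sets that keep a positive distance from each other, and \<open>p n\<close> names a point of \<open>S\<close> near each of
  them, which is why it is locally constant. As in the classical proof of A. H. Stone's theorem, the
  separation comes from a well-order: the index of \<open>x\<close> at level \<open>n\<close> is a point \<open>i\<close> which is closer
  to \<open>x\<close> than \<open>\<delta>\<close> by a margin \<open>2 * h n\<close>, while no smaller point is closer than \<open>\<delta>\<close> by more
  than \<open>h n\<close>. Two points of \<open>V n\<close> with different indices then are at least \<open>h n\<close> apart.
\<close>

lemma sigma_discrete_nearby_points:
  fixes S :: "'a::metric_space set"
  assumes "\<delta> > 0"
  obtains V :: "nat \<Rightarrow> 'a set" and p :: "nat \<Rightarrow> 'a \<Rightarrow> 'a"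
  where "\<And>n. open (V n)" and "S \<subseteq> (\<Union>n. V n)"
    and "\<And>n x. x \<in> V n \<Longrightarrow> p n x \<in> S \<inter> ball x \<delta>"
    and "\<And>n x. x \<in> V n \<Longrightarrow> \<forall>\<^sub>F y in nhds x. p n y = p n x"
proof -
  obtain r :: "'a rel" where r: "well_order_on UNIV r"
    using well_order_on by blast
  define L where "L = r - Id"
  have wfL: "wf L"
    using r by (simp add: well_order_on_def L_def)
  have totL: "i = j \<or> (i, j) \<in> L \<or> (j, i) \<in> L" for i j
    using r by (auto simp: well_order_on_def linear_order_on_def total_on_def L_def)
  define h where "h n = \<delta> / real (n + 1)" for n
  have hpos: "h n > 0" for n
    using assms by (simp add: h_def)
  define Q where "Q n i x \<longleftrightarrow> i \<in> S \<and> dist x i < \<delta> - 2 * h n \<and>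
      (\<forall>j\<in>S. (j, i) \<in> L \<longrightarrow> \<delta> - h n \<le> dist x j)" for n i x
  define V where "V n = interior {x. \<exists>i. Q n i x}" for n
  define p where "p n x = (SOME i. Q n i x)" for n x
  have Qp: "Q n (p n x) x" if "x \<in> V n" for n x
    using that interior_subset unfolding V_def p_def by (metis (mono_tags, lifting) mem_Collect_eq someI_ex subsetD)
  have Qless: False if "Q n i x" "Q n j y" "dist x y < h n" "(i, j) \<in> L" for n i j x y
  proof -
    have "\<delta> - h n \<le> dist y i" "dist x i < \<delta> - 2 * h n"
      using that by (auto simp: Q_def)
    then show False
      using that(3) dist_triangle[of y i x] by (simp add: dist_commute)
  qed
  have Quniq: "i = j" if "Q n i x" "Q n j y" "dist x y < h n" for n i j x y
    using Qless[of n i x j y] Qless[of n j y i x] that totL[of i j] by (auto simp: dist_commute)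
  show thesis
  proof
    show "open (V n)" for n
      by (simp add: V_def)
    \<comment> \<open>The least point of \<open>S\<close> closer to \<open>x\<close> than \<open>\<delta>\<close> is an index of \<open>x\<close> as soon as \<open>h n\<close> is small
      compared with the slack \<open>\<delta> - dist x i\<close>.\<close>
    show "S \<subseteq> (\<Union>n. V n)"
    proof
      fix x assume "x \<in> S"
      then have "x \<in> {i \<in> S. dist x i < \<delta>}"
        using assms by simp
      then obtain i where i: "i \<in> S" "dist x i < \<delta>"
        and imin: "\<And>j. (j, i) \<in> L \<Longrightarrow> j \<in> S \<Longrightarrow> \<delta> \<le> dist x j"
        using wfE_min[OF wfL] by (metis (no_types, lifting) mem_Collect_eq not_le)
      have "h \<longlonglongrightarrow> 0"
        unfolding h_def using LIMSEQ_ignore_initial_segment[OF lim_const_over_n[of \<delta>], of 1] by simp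
      then have "\<forall>\<^sub>F n in sequentially. h n < (\<delta> - dist x i) / 4"
        using i by (intro order_tendstoD) auto
      then obtain n where n: "h n < (\<delta> - dist x i) / 4"
        by (auto simp: eventually_sequentially)
      have "ball x (h n) \<subseteq> {y. \<exists>i. Q n i y}"
      proof (rule subsetI, rule CollectI, rule exI)
        fix y assume y: "y \<in> ball x (h n)"
        have "dist y i < \<delta> - 2 * h n"
          using y n dist_triangle[of y i x] hpos[of n] by (simp add: dist_commute)
        moreover have "\<delta> - h n \<le> dist y j" if "j \<in> S" "(j, i) \<in> L" for j
          using imin[OF that(2,1)] y dist_triangle[of x j y] by simp
        ultimately show "Q n i y"
          using i by (simp add: Q_def)
      qed
      then have "x \<in> V n"
        unfolding V_def using hpos by (meson centre_in_ball interiorI open_ball)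
      then show "x \<in> (\<Union>n. V n)" by blast
    qed
    show "p n x \<in> S \<inter> ball x \<delta>" if "x \<in> V n" for n x
      using Qp[OF that] hpos[of n] by (simp add: Q_def)
    show "\<forall>\<^sub>F y in nhds x. p n y = p n x" if "x \<in> V n" for n x
    proof -
      have "\<forall>\<^sub>F y in nhds x. y \<in> V n"
        using that by (intro eventually_nhds_in_open) (auto simp: V_def)
      moreover have "\<forall>\<^sub>F y in nhds x. dist y x < h n"
        using hpos by (auto simp: eventually_nhds_metric)
      ultimately show ?thesis
        by eventually_elim (use Qp that Quniq in blast)
    qed
  qed
qed

lemma open_bump_function:
  fixes U :: "'a::metric_space set"
  assumes "open U"
  obtains c :: "'a \<Rightarrow> real"
  where "continuous_on UNIV c" and "\<And>x. 0 \<le> c x" and "\<And>x. c x \<le> 1" and "\<And>x. c x > 0 \<longleftrightarrow> x \<in> U"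
proof (cases "U = UNIV")
  case True
  then show ?thesis by (intro that[of "\<lambda>_. 1"]) auto
next
  case False
  show ?thesis
  proof (rule that[of "\<lambda>x. min 1 (infdist x (- U))"])
    show "continuous_on UNIV (\<lambda>x. min 1 (infdist x (- U)))"
      by (intro continuous_intros)
    show "0 < min 1 (infdist x (- U)) \<longleftrightarrow> x \<in> U" for x
    proof -
      have "closed (- U)" "- U \<noteq> {}"
        using assms False by auto
      then have "infdist x (- U) = 0 \<longleftrightarrow> x \<notin> U"
        using in_closed_iff_infdist_zero[of "- U" x] by simp
      then show ?thesis
        using infdist_nonneg[of x "- U"] by (auto simp: min_less_iff_conj less_le min_def split: if_splits)
    qed
  qed (auto simp: infdist_nonneg)
qed

text \<open>
  An infinite convex combination is a limit of finite ones, obtained by normalizing the partial sums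
  from the first positive weight on.
\<close>

lemma normalized_suminf_in_closed_convex:
  fixes p :: "nat \<Rightarrow> 'b::real_normed_vector"
  assumes K: "closed K" "convex K"
    and w: "\<And>n. 0 \<le> w n" "summable w" "0 < suminf w"
    and p: "\<And>n. 0 < w n \<Longrightarrow> p n \<in> K"
    and sm: "summable (\<lambda>n. w n *\<^sub>R p n)"
  shows "(\<Sum>n. w n *\<^sub>R p n) /\<^sub>R suminf w \<in> K"
proof -
  obtain m where m: "0 < w m"
    using w by (metis less_eq_real_def less_irrefl suminf_eq_zero_iff)
  \<comment> \<open>Points of weight zero may lie outside \<open>K\<close> and are moved into it.\<close>
  define q where "q n = (if 0 < w n then p n else p m)" for n
  have q: "q n \<in> K" for n
    using p m by (simp add: q_def)
  have wq: "w n *\<^sub>R p n = w n *\<^sub>R q n" for n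
    using w(1)[of n] by (auto simp: q_def)
  have lim: "(\<lambda>N. (\<Sum>n<N. w n *\<^sub>R p n) /\<^sub>R (\<Sum>n<N. w n)) \<longlonglongrightarrow> (\<Sum>n. w n *\<^sub>R p n) /\<^sub>R suminf w"
    using w sm by (intro tendsto_intros summable_LIMSEQ) auto
  have "(\<Sum>n<N. w n *\<^sub>R p n) /\<^sub>R (\<Sum>n<N. w n) \<in> K" if "N > m" for N
  proof -
    have pos: "0 < (\<Sum>n<N. w n)"
      using that m w(1) by (intro sum_pos2[of _ m]) auto
    have "(\<Sum>n<N. (w n / (\<Sum>n<N. w n)) *\<^sub>R q n) \<in> K"
      using K(2) w(1) q pos by (intro convex_sum) (auto simp: sum_divide_distrib[symmetric] intro!: divide_nonneg_pos)
    then show ?thesis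
      by (simp add: wq scaleR_sum_right divide_inverse mult.commute)
  qed
  then have "\<forall>\<^sub>F N in sequentially. (\<Sum>n<N. w n *\<^sub>R p n) /\<^sub>R (\<Sum>n<N. w n) \<in> K"
    using eventually_gt_at_top[of m] by (rule eventually_mono[rotated])
  then show ?thesis
    using Lim_in_closed_set[OF K(1) _ _ lim] by simp
qed

lemma continuous_on_suminf:
  fixes F :: "nat \<Rightarrow> 'a::topological_space \<Rightarrow> 'b::banach"
  assumes "\<And>n. continuous_on A (F n)" and "\<And>n x. x \<in> A \<Longrightarrow> norm (F n x) \<le> M n" and "summable M"
  shows "continuous_on A (\<lambda>x. \<Sum>n. F n x)"
  by (rule uniform_limit_theorem[OF _ Weierstrass_m_test[of A F M]])
     (use assms in \<open>auto intro!: continuous_on_sum always_eventually\<close>)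

text \<open>
  On \<open>V n\<close> the value of \<open>f\<close> at the nearby point \<open>p n x\<close> is locally constant in \<open>x\<close>. Multiplied by a
  bump function supported on \<open>V n\<close> it becomes continuous everywhere, as \<open>f\<close> is bounded. Weighting
  the levels by \<open>(1/2)\<^sup>n\<close> makes both the sum of these functions and the sum of the weights converge
  uniformly; their quotient is the required average.
\<close>

theorem approximate_continuous_selection:
  fixes f :: "'a::metric_space \<Rightarrow> 'b::banach"
  assumes "bounded (f ` S)" and "\<delta> > 0"
  obtains g where "continuous_on S g"
    and "\<And>x. x \<in> S \<Longrightarrow> g x \<in> closure (convex hull (f ` (S \<inter> ball x \<delta>)))"
proof -
  obtain V :: "nat \<Rightarrow> 'a set" and p :: "nat \<Rightarrow> 'a \<Rightarrow> 'a" where V: "\<And>n. open (V n)" "S \<subseteq> (\<Union>n. V n)"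
    and p: "\<And>n x. x \<in> V n \<Longrightarrow> p n x \<in> S \<inter> ball x \<delta>"
    and ploc: "\<And>n x. x \<in> V n \<Longrightarrow> \<forall>\<^sub>F y in nhds x. p n y = p n x"
    using sigma_discrete_nearby_points[OF assms(2), of S] by metis
  have "\<exists>c::nat \<Rightarrow> 'a \<Rightarrow> real. \<forall>n. continuous_on UNIV (c n) \<and> (\<forall>x. 0 \<le> c n x \<and> c n x \<le> 1 \<and> (c n x > 0 \<longleftrightarrow> x \<in> V n))"
    by (rule choice) (metis open_bump_function[OF V(1)])
  then obtain c :: "nat \<Rightarrow> 'a \<Rightarrow> real" where c: "\<And>n. continuous_on UNIV (c n)" "\<And>n x. 0 \<le> c n x" "\<And>n x. c n x \<le> 1"
    "\<And>n x. c n x > 0 \<longleftrightarrow> x \<in> V n"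
    by blast
  obtain B where B: "B > 0" "\<And>x. x \<in> S \<Longrightarrow> norm (f x) \<le> B"
    using assms(1) by (auto simp: bounded_pos)
  have cf: "norm (c n x *\<^sub>R f (p n x)) \<le> c n x * B" for n x
  proof (cases "x \<in> V n")
    case True
    then show ?thesis using p[of x n] B(2)[of "p n x"] c(2)[of n x] by (simp add: mult_left_mono)
  next
    case False
    then have "c n x = 0" using c(2)[of n x] c(4)[of n x] by simp
    then show ?thesis by simp
  qed
  have contF: "continuous_on UNIV (\<lambda>x. c n x *\<^sub>R f (p n x))" for n
    unfolding continuous_on_eq_continuous_at[OF open_UNIV]
  proof
    fix x
    have cx: "isCont (c n) x"
      using c(1)[of n] by (simp add: continuous_on_eq_continuous_at)
    show "isCont (\<lambda>x. c n x *\<^sub>R f (p n x)) x"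
    proof (cases "x \<in> V n")
      case True
      have "\<forall>\<^sub>F y in nhds x. c n y *\<^sub>R f (p n y) = c n y *\<^sub>R f (p n x)"
        using ploc[OF True] by eventually_elim simp
      moreover have "isCont (\<lambda>y. c n y *\<^sub>R f (p n x)) x"
        using cx by (intro continuous_intros)
      ultimately show ?thesis
        using isCont_cong by fastforce
    next
      case False
      then have 0: "c n x = 0" using c(2)[of n x] c(4)[of n x] by simp
      then have "((\<lambda>y. c n y * B) \<longlongrightarrow> 0) (at x)"
        using cx unfolding isCont_def by (intro tendsto_eq_intros) auto
      then have "((\<lambda>y. c n y *\<^sub>R f (p n y)) \<longlongrightarrow> 0) (at x)"
        by (rule Lim_null_comparison[rotated]) (simp add: cf del: norm_scaleR)
      then show ?thesis using 0 by (simp add: isCont_def)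
    qed
  qed
  define w where "w n x = (1/2)^n * c n x" for n x
  have w0: "0 \<le> w n x" for n x using c(2) by (simp add: w_def)
  have w1: "norm (w n x) \<le> (1/2)^n" for n x
    using c(2,3) by (simp add: w_def mult_left_le)
  have geo: "summable (\<lambda>n. (1/2)^n :: real)" "summable (\<lambda>n. (1/2)^n * B)"
    by (auto intro!: summable_mult2 summable_geometric)
  have wf1: "norm (w n x *\<^sub>R f (p n x)) \<le> (1/2)^n * B" for n x
  proof -
    have "norm (w n x *\<^sub>R f (p n x)) = (1/2)^n * norm (c n x *\<^sub>R f (p n x))"
      using c(2) by (simp add: w_def abs_mult)
    also have "\<dots> \<le> (1/2)^n * (c n x * B)"
      using cf by (intro mult_left_mono) auto
    also have "\<dots> \<le> (1/2)^n * (1 * B)"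
      using c(3) B(1) by (intro mult_left_mono mult_right_mono) auto
    finally show ?thesis by simp
  qed
  have smw: "summable (\<lambda>n. w n x)" for x
    by (rule summable_comparison_test'[OF geo(1), of 0]) (rule w1)
  have smwf: "summable (\<lambda>n. w n x *\<^sub>R f (p n x))" for x
    by (rule summable_comparison_test'[OF geo(2), of 0]) (rule wf1)
  have Wpos: "0 < (\<Sum>n. w n x)" if x: "x \<in> S" for x
  proof -
    obtain n where "x \<in> V n" using V(2) x by blast
    then have "0 < w n x" using c(4) by (simp add: w_def)
    then show ?thesis using suminf_pos2[OF smw, of x n] w0 by blast
  qed
  show thesis
  proof
    have "continuous_on S (\<lambda>x. \<Sum>n. w n x)"
    proof (rule continuous_on_suminf[OF _ w1 geo(1)])
      show "continuous_on S (w n)" for n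
        unfolding w_def[abs_def] by (intro continuous_intros continuous_on_subset[OF c(1)]) auto
    qed
    moreover have "continuous_on S (\<lambda>x. \<Sum>n. w n x *\<^sub>R f (p n x))"
    proof (rule continuous_on_suminf[OF _ wf1 geo(2)])
      have "continuous_on S (\<lambda>x. (1/2)^n *\<^sub>R (c n x *\<^sub>R f (p n x)))" for n
        by (intro continuous_intros continuous_on_subset[OF contF]) auto
      then show "continuous_on S (\<lambda>x. w n x *\<^sub>R f (p n x))" for n
        by (simp add: w_def)
    qed
    ultimately show "continuous_on S (\<lambda>x. (\<Sum>n. w n x *\<^sub>R f (p n x)) /\<^sub>R (\<Sum>n. w n x))"
      using Wpos by (intro continuous_intros) force+
    show "(\<Sum>n. w n x *\<^sub>R f (p n x)) /\<^sub>R (\<Sum>n. w n x) \<in> closure (convex hull (f ` (S \<inter> ball x \<delta>)))" if "x \<in> S" for x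
    proof (rule normalized_suminf_in_closed_convex)
      show "f (p n x) \<in> closure (convex hull (f ` (S \<inter> ball x \<delta>)))" if "0 < w n x" for n
      proof -
        have "x \<in> V n" using that c(4) by (simp add: w_def zero_less_mult_iff)
        then have "f (p n x) \<in> f ` (S \<inter> ball x \<delta>)" using p by blast
        then show ?thesis using hull_subset[of "f ` (S \<inter> ball x \<delta>)" convex] closure_subset by blast
      qed
    qed (rule w0 smw smwf Wpos[OF that] closed_closure convex_closure convex_convex_hull)+
  qed
qed

section \<open>Positively homogeneous maps\<close>

text \<open>
  The linear bound is what gives continuity at \<open>0\<close>: continuity on the sphere alone does not make
  \<open>\<gamma>\<close> bounded there in infinite dimensions.
\<close>

lemma continuous_positively_homogeneous:
  fixes \<gamma> :: "'a::real_normed_vector \<Rightarrow> 'b::real_normed_vector"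
  assumes hom: "positively_homogeneous \<gamma>" and bd: "\<And>x. norm (\<gamma> x) \<le> M * norm x"
    and cont: "continuous_on (sphere 0 1) \<gamma>"
  shows "continuous_on UNIV \<gamma>"
  unfolding continuous_on_eq_continuous_at[OF open_UNIV]
proof
  fix x
  show "isCont \<gamma> x"
  proof (cases "x = 0")
    case True
    have "((\<lambda>y. M * norm y) \<longlongrightarrow> 0) (at 0)"
      by (intro tendsto_eq_intros) auto
    then have "(\<gamma> \<longlongrightarrow> 0) (at 0)"
      by (rule Lim_null_comparison[rotated]) (simp add: bd)
    moreover have "\<gamma> 0 = 0" using bd[of 0] by simp
    ultimately show ?thesis using True by (simp add: isCont_def)
  next
    case False
    have "continuous_on (- {0}) (\<lambda>y. norm y *\<^sub>R \<gamma> (y /\<^sub>R norm y))"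
      by (intro continuous_intros continuous_on_compose2[OF cont])
        (auto simp: field_simps split: if_splits)
    moreover have "norm y *\<^sub>R \<gamma> (y /\<^sub>R norm y) = \<gamma> y" if "y \<in> - {0}" for y
      using hom[unfolded positively_homogeneous_def, rule_format, of "norm y" "y /\<^sub>R norm y"] that by simp
    ultimately have "continuous_on (- {0}) \<gamma>"
      by (rule continuous_on_eq)
    then show ?thesis
      using False by (simp add: continuous_on_eq_continuous_at open_Compl)
  qed
qed

lemma positively_homogeneous_radial_extension:
  "positively_homogeneous (\<lambda>x. norm x *\<^sub>R g (x /\<^sub>R norm x))"
  unfolding positively_homogeneous_def
proof (intro allI impI)
  fix x :: 'a and c :: real assume "0 \<le> c"
  then show "norm (c *\<^sub>R x) *\<^sub>R g ((c *\<^sub>R x) /\<^sub>R norm (c *\<^sub>R x)) = c *\<^sub>R norm x *\<^sub>R g (x /\<^sub>R norm x)"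
    by (cases "c = 0") (auto simp: field_simps)
qed

lemma positively_homogeneous_funpow:
  fixes R :: "'a::real_vector \<Rightarrow> 'a"
  assumes "positively_homogeneous R"
  shows "positively_homogeneous (R ^^ n)"
  by (induction n) (use assms in \<open>simp_all add: positively_homogeneous_def\<close>)

text \<open>
  With \<open>R\<close> the remainder of one approximate decomposition and \<open>G\<close> one of its two parts, the series
  is the corresponding part of the exact decomposition. It is dominated by a geometric series which
  is uniform only on bounded sets; homogeneity reduces continuity to the unit sphere.
\<close>

lemma iterated_series:
  fixes R :: "'a::real_normed_vector \<Rightarrow> 'a" and G :: "'a \<Rightarrow> 'b::banach"
  assumes R: "positively_homogeneous R" "continuous_on UNIV R" "\<And>x. norm (R x) \<le> \<delta> * norm x"
    and \<delta>: "0 \<le> \<delta>" "\<delta> < 1"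
    and G: "positively_homogeneous G" "continuous_on UNIV G" "\<And>x. norm (G x) \<le> M * norm x" and M: "0 \<le> M"
  shows "summable (\<lambda>n. G ((R ^^ n) x))" 
    and "continuous_on UNIV (\<lambda>x. \<Sum>n. G ((R ^^ n) x))"
    and "positively_homogeneous (\<lambda>x. \<Sum>n. G ((R ^^ n) x))"
    and "norm (\<Sum>n. G ((R ^^ n) x)) \<le> M / (1 - \<delta>) * norm x"
proof -
  have Rn: "norm ((R ^^ n) x) \<le> \<delta> ^ n * norm x" for n x
  proof (induction n)
    case (Suc n)
    have "norm ((R ^^ Suc n) x) \<le> \<delta> * norm ((R ^^ n) x)" using R(3) by simp
    also have "\<dots> \<le> \<delta> * (\<delta> ^ n * norm x)" using Suc \<delta> by (intro mult_left_mono) auto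
    finally show ?case by simp
  qed simp
  have GR: "norm (G ((R ^^ n) x)) \<le> \<delta> ^ n * (M * norm x)" for n x
  proof -
    have "norm (G ((R ^^ n) x)) \<le> M * norm ((R ^^ n) x)" by (rule G(3))
    also have "\<dots> \<le> M * (\<delta> ^ n * norm x)" using Rn M by (intro mult_left_mono) auto
    finally show ?thesis by (simp add: mult_ac)
  qed
  have geo: "(\<lambda>n. \<delta> ^ n * C) sums (1 / (1 - \<delta>) * C)" for C
    using \<delta> by (intro sums_mult2 geometric_sums) auto
  show sm: "summable (\<lambda>n. G ((R ^^ n) x))" for x
    by (rule summable_comparison_test'[OF sums_summable[OF geo], of 0]) (rule GR)
  show bd: "norm (\<Sum>n. G ((R ^^ n) x)) \<le> M / (1 - \<delta>) * norm x" for x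
    using norm_suminf_le[OF GR sums_summable[OF geo], of x] sums_unique[OF geo, of "M * norm x"] by simp
  show hom: "positively_homogeneous (\<lambda>x. \<Sum>n. G ((R ^^ n) x))"
    unfolding positively_homogeneous_def
  proof (intro allI impI)
    fix x :: 'a and c :: real assume "0 \<le> c"
    then have "G ((R ^^ n) (c *\<^sub>R x)) = c *\<^sub>R G ((R ^^ n) x)" for n
      using positively_homogeneous_funpow[OF R(1), of n] G(1)
      unfolding positively_homogeneous_def by metis
    then show "(\<Sum>n. G ((R ^^ n) (c *\<^sub>R x))) = c *\<^sub>R (\<Sum>n. G ((R ^^ n) x))"
      by (simp only: suminf_scaleR_right[OF sm])
  qed
  have contRn: "continuous_on UNIV (R ^^ n)" for n
  proof (induction n)
    case (Suc n)
    then show ?case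
      using continuous_on_compose[OF Suc continuous_on_subset[OF R(2)]] by simp
  qed (simp add: id_def)
  show "continuous_on UNIV (\<lambda>x. \<Sum>n. G ((R ^^ n) x))"
  proof (rule continuous_positively_homogeneous[OF hom bd])
    show "continuous_on (sphere 0 1) (\<lambda>x. \<Sum>n. G ((R ^^ n) x))"
    proof (rule continuous_on_suminf[of _ _ "\<lambda>n. \<delta> ^ n * M"])
      show "continuous_on (sphere 0 1) (\<lambda>x. G ((R ^^ n) x))" for n
        by (rule continuous_on_compose2[OF G(2) continuous_on_subset[OF contRn]]) auto
      show "norm (G ((R ^^ n) x)) \<le> \<delta> ^ n * M" if "x \<in> sphere 0 1" for n x
        using GR[of n x] that by simp
    qed (rule sums_summable[OF geo])
  qed
qed

section \<open>Decompositions along a cone\<close>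

lemma order_cone_add: "order_cone C \<Longrightarrow> x \<in> C \<Longrightarrow> y \<in> C \<Longrightarrow> x + y \<in> C"
  by (auto simp: order_cone_def)

lemma order_cone_scaleR: "order_cone C \<Longrightarrow> x \<in> C \<Longrightarrow> 0 \<le> c \<Longrightarrow> c *\<^sub>R x \<in> C"
  by (auto simp: order_cone_def)

lemma order_cone_zero: "order_cone C \<Longrightarrow> x \<in> C \<Longrightarrow> 0 \<in> C"
  using order_cone_scaleR[of C x 0] by simp

lemma order_cone_convex: "order_cone C \<Longrightarrow> convex C"
  by (auto simp: convex_def intro: order_cone_add order_cone_scaleR)

lemma order_cone_sum:
  assumes "order_cone C" "0 \<in> C" "\<And>i. i \<in> I \<Longrightarrow> f i \<in> C"
  shows "sum f I \<in> C"
  using assms(3) by (induction I rule: infinite_finite_induct) (auto simp: assms(2) intro: order_cone_add[OF assms(1)])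

lemma order_cone_suminf:
  fixes C :: "'a::real_normed_vector set"
  assumes "order_cone C" "closed C" "0 \<in> C" "\<And>n. f n \<in> C" "summable f"
  shows "suminf f \<in> C"
proof (rule closed_sequentially[OF assms(2) _ summable_LIMSEQ[OF assms(5)]])
  show "(\<Sum>i<n. f i) \<in> C" for n
    by (rule order_cone_sum[OF assms(1,3,4)])
qed

text \<open>
  At a unit vector \<open>x\<close>, the pointwise requirements on the pair \<open>(G x, H x)\<close> define a closed convex
  set \<open>K x\<close>. It contains the decomposition chosen for any unit vector within \<open>\<delta>\<close> of \<open>x\<close>, hence
  also the averages of such decompositions. Treating both parts as one point of the product space
  averages them with the same weights, which the estimate of the remainder depends on.
\<close>

lemma approximate_continuous_decomposition:
  fixes C :: "'a::banach set"
  assumes C: "order_cone C" "closed C" and con: "conormal a C" and \<delta>: "0 < \<delta>"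
  obtains G H :: "'a \<Rightarrow> 'a" where
    "range G \<subseteq> C" "range H \<subseteq> C" "continuous_on UNIV G" "continuous_on UNIV H"
    "positively_homogeneous G" "positively_homogeneous H"
    "\<And>x. norm (G x) \<le> a * norm x" "\<And>x. norm (H x) \<le> (a + 1) * norm x"
    "\<And>x. norm (x - G x + H x) \<le> \<delta> * norm x"
proof -
  have "\<forall>x. \<exists>z. fst z \<in> C \<and> snd z \<in> C \<and> x = fst z - snd z \<and> norm (fst z) \<le> a * norm x"
    using con unfolding conormal_def by fastforce
  then obtain z where z: "\<And>x. fst (z x) \<in> C \<and> snd (z x) \<in> C \<and> x = fst (z x) - snd (z x) \<and> norm (fst (z x)) \<le> a * norm x"
    by (rule choice[THEN exE]) blast
  define u v where "u x = fst (z x)" and "v x = snd (z x)" for x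
  have uv: "\<And>x. u x \<in> C" "\<And>x. v x \<in> C" "\<And>x. x = u x - v x" "\<And>x. norm (u x) \<le> a * norm x"
    using z unfolding u_def v_def by blast+
  have v: "norm (v x) \<le> (a + 1) * norm x" for x
  proof -
    have "v x = u x - x"
      using uv(3)[of x] by (metis add_diff_cancel_left' diff_add_cancel)
    then show ?thesis
      using uv(4)[of x] norm_triangle_ineq4[of "u x" x] by (simp add: distrib_right)
  qed
  define K where "K x = {z \<in> C \<times> C. fst z \<in> cball 0 a \<and> snd z \<in> cball 0 (a + 1) \<and> fst z - snd z \<in> cball x \<delta>}" for x :: 'a
  have K: "K x = (C \<times> C) \<inter> fst -` cball 0 a \<inter> snd -` cball 0 (a + 1) \<inter> (\<lambda>z. fst z - snd z) -` cball x \<delta>" for x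
    by (auto simp: K_def)
  have clK: "closed (K x)" for x
    unfolding K using C(2) by (intro closed_Int closed_Times closed_vimage continuous_intros) auto
  have cvK: "convex (K x)" for x
    unfolding K using C(1)
    by (intro convex_Int convex_Times convex_linear_vimage linear_fst linear_snd linear_compose_sub convex_cball order_cone_convex)
  define f where "f x = (u x, v x)" for x
  have "norm (f x) \<le> a + (a + 1)" if "x \<in> sphere 0 1" for x
    using norm_Pair_le[of "u x" "v x"] uv(4)[of x] v[of x] that by (simp add: f_def)
  then have "bounded (f ` sphere 0 1)"
    unfolding bounded_iff by blast
  then obtain g where g: "continuous_on (sphere 0 1) g"
    and gc: "\<And>x. x \<in> sphere 0 1 \<Longrightarrow> g x \<in> closure (convex hull (f ` (sphere 0 1 \<inter> ball x \<delta>)))"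
    using approximate_continuous_selection[of f "sphere 0 1" \<delta>] \<delta> by metis
  have gK: "g x \<in> K x" if "x \<in> sphere 0 1" for x
  proof -
    have "f y \<in> K x" if "y \<in> sphere 0 1 \<inter> ball x \<delta>" for y
      using that uv(1,2,4)[of y] uv(3)[of y] v[of y] by (simp add: f_def K_def)
    then have "closure (convex hull (f ` (sphere 0 1 \<inter> ball x \<delta>))) \<subseteq> K x"
      by (intro closure_minimal hull_minimal clK cvK) auto
    then show ?thesis using gc[OF that] by blast
  qed
  define e where "e x = x /\<^sub>R norm x" for x :: 'a
  have e: "g (e x) \<in> K (e x)" if "x \<noteq> 0" for x
    using that by (intro gK) (simp add: e_def)
  have ne: "norm x *\<^sub>R e x = x" for x by (cases "x = 0") (simp_all add: e_def)
  have C0: "0 \<in> C" using order_cone_zero[OF C(1) uv(1)] .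
  define G where "G x = norm x *\<^sub>R fst (g (e x))" for x
  define H where "H x = norm x *\<^sub>R snd (g (e x))" for x
  have hom: "positively_homogeneous G" "positively_homogeneous H"
    using positively_homogeneous_radial_extension[of "fst \<circ> g"] positively_homogeneous_radial_extension[of "snd \<circ> g"]
    by (simp_all add: G_def[abs_def] H_def[abs_def] e_def)
  have bG: "norm (G x) \<le> a * norm x" for x
    using e[of x] by (cases "x = 0") (auto simp: G_def K_def mult.commute intro!: mult_right_mono)
  have bH: "norm (H x) \<le> (a + 1) * norm x" for x
    using e[of x] by (cases "x = 0") (auto simp: H_def K_def mult.commute intro!: mult_right_mono)
  have sph: "norm x = 1 \<Longrightarrow> G x = fst (g x) \<and> H x = snd (g x)" for x
    by (simp add: G_def H_def e_def)
  show thesis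
  proof
    have "G x \<in> C \<and> H x \<in> C" for x
    proof (cases "x = 0")
      case False
      then have "fst (g (e x)) \<in> C" "snd (g (e x)) \<in> C"
        using e[OF False] by (auto simp: K_def)
      then show ?thesis
        by (simp add: G_def H_def order_cone_scaleR[OF C(1)])
    qed (simp add: G_def H_def C0)
    then show "range G \<subseteq> C" "range H \<subseteq> C"
      by auto
    show "continuous_on UNIV G"
    proof (rule continuous_positively_homogeneous[OF hom(1) bG])
      show "continuous_on (sphere 0 1) G"
        using continuous_on_fst[OF g] by (rule continuous_on_eq) (simp add: sph)
    qed
    show "continuous_on UNIV H"
    proof (rule continuous_positively_homogeneous[OF hom(2) bH])
      show "continuous_on (sphere 0 1) H"
        using continuous_on_snd[OF g] by (rule continuous_on_eq) (simp add: sph)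
    qed
    show "norm (x - G x + H x) \<le> \<delta> * norm x" for x
    proof (cases "x = 0")
      case False
      have "x - G x + H x = norm x *\<^sub>R (e x - (fst (g (e x)) - snd (g (e x))))"
        by (simp add: G_def H_def ne algebra_simps)
      moreover have "norm (e x - (fst (g (e x)) - snd (g (e x)))) \<le> \<delta>"
        using e[OF False] by (simp add: K_def dist_norm)
      ultimately show ?thesis by (simp add: mult.commute[of \<delta>] mult_left_mono)
    qed (simp add: G_def H_def)
  qed (rule hom bG bH)+
qed

section \<open>Approximate conormality and continuous decompositions\<close>

theorem corollary4p3:
  fixes Xpos :: "'a::banach set" and \<alpha> :: real
  assumes "order_cone Xpos" and "closed Xpos" and "generating Xpos" and "\<alpha> > 0"
  shows "approximately_conormal \<alpha> Xpos \<longleftrightarrow>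
    (\<forall>\<epsilon>>0. \<exists>\<gamma>p \<gamma>m :: 'a \<Rightarrow> 'a.
       range \<gamma>p \<subseteq> Xpos \<and> range \<gamma>m \<subseteq> Xpos \<and>
       continuous_on UNIV \<gamma>p \<and> continuous_on UNIV \<gamma>m \<and>
       positively_homogeneous \<gamma>p \<and> positively_homogeneous \<gamma>m \<and>
       (\<forall>x. x = \<gamma>p x - \<gamma>m x) \<and>
       (\<forall>x. norm (\<gamma>p x) \<le> (\<alpha> + \<epsilon>) * norm x))"
  (is "_ \<longleftrightarrow> (\<forall>\<epsilon>>0. \<exists>\<gamma>p \<gamma>m. ?P \<epsilon> \<gamma>p \<gamma>m)")
proof
  assume conormal: "approximately_conormal \<alpha> Xpos"
  show "\<forall>\<epsilon>>0. \<exists>\<gamma>p \<gamma>m. ?P \<epsilon> \<gamma>p \<gamma>m"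
  proof (intro allI impI)
    fix \<epsilon> :: real assume \<epsilon>: "0 < \<epsilon>"
    \<comment> \<open>Half of \<open>\<epsilon>\<close> is spent on the pointwise choice, and \<open>\<delta>\<close> is the value for which the geometric
      series uses up the rest: \<open>a / (1 - \<delta>) = \<alpha> + \<epsilon>\<close>.\<close>
    define a where "a = \<alpha> + \<epsilon> / 2"
    define \<delta> where "\<delta> = (\<epsilon> / 2) / (\<alpha> + \<epsilon>)"
    have a: "a > 0" and \<delta>: "0 < \<delta>" "\<delta> < 1" and a\<delta>: "a / (1 - \<delta>) = \<alpha> + \<epsilon>"
      using assms(4) \<epsilon> by (auto simp: a_def \<delta>_def field_simps)
    have "conormal a Xpos"
      using conormal \<epsilon> by (simp add: approximately_conormal_def a_def)
    then obtain G H :: "'a \<Rightarrow> 'a" where pos: "range G \<subseteq> Xpos" "range H \<subseteq> Xpos"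
      and cont: "continuous_on UNIV G" "continuous_on UNIV H"
      and hom: "positively_homogeneous G" "positively_homogeneous H"
      and bd: "\<And>x. norm (G x) \<le> a * norm x" "\<And>x. norm (H x) \<le> (a + 1) * norm x"
      and err: "\<And>x. norm (x - G x + H x) \<le> \<delta> * norm x"
      using approximate_continuous_decomposition[OF assms(1,2) _ \<delta>(1)] by metis
    define R where "R x = x - G x + H x" for x
    have R: "positively_homogeneous R" "continuous_on UNIV R" "\<And>x. norm (R x) \<le> \<delta> * norm x"
      using hom cont err unfolding R_def[abs_def]
      by (auto simp: positively_homogeneous_def algebra_simps intro!: continuous_intros)
    have a1: "0 \<le> a" "0 \<le> a + 1" using a by auto
    note SG = iterated_series[OF R less_imp_le[OF \<delta>(1)] \<delta>(2) hom(1) cont(1) bd(1) a1(1)]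
    note SH = iterated_series[OF R less_imp_le[OF \<delta>(1)] \<delta>(2) hom(2) cont(2) bd(2) a1(2)]
    define \<gamma>p where "\<gamma>p x = (\<Sum>n. G ((R ^^ n) x))" for x
    define \<gamma>m where "\<gamma>m x = (\<Sum>n. H ((R ^^ n) x))" for x
    have 0: "0 \<in> Xpos" using order_cone_zero[OF assms(1)] pos by blast
    have "?P \<epsilon> \<gamma>p \<gamma>m"
    proof (intro conjI allI)
      show "range \<gamma>p \<subseteq> Xpos" "range \<gamma>m \<subseteq> Xpos"
        using pos SG(1) SH(1) by (auto simp: \<gamma>p_def \<gamma>m_def intro!: order_cone_suminf[OF assms(1,2) 0])
      show "x = \<gamma>p x - \<gamma>m x" for x
      proof -
        have ident: "continuous_on UNIV (\<lambda>x::'a. x)" "positively_homogeneous (\<lambda>x::'a. x)"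
          by (auto simp: positively_homogeneous_def)
        have "summable (\<lambda>n. (R ^^ n) x)"
          using iterated_series(1)[OF R less_imp_le[OF \<delta>(1)] \<delta>(2) ident(2,1), of 1] by simp
        then have "(\<lambda>n. (R ^^ n) x - (R ^^ Suc n) x) sums ((R ^^ 0) x - 0)"
          by (intro telescope_sums' summable_LIMSEQ_zero)
        moreover have "(R ^^ n) x - (R ^^ Suc n) x = G ((R ^^ n) x) - H ((R ^^ n) x)" for n
          by (simp add: R_def)
        ultimately have "(\<Sum>n. G ((R ^^ n) x) - H ((R ^^ n) x)) = x"
          by (simp add: sums_iff)
        then show ?thesis
          using suminf_diff[OF SG(1) SH(1)] by (simp add: \<gamma>p_def \<gamma>m_def)
      qed
      show "norm (\<gamma>p x) \<le> (\<alpha> + \<epsilon>) * norm x" for x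
        using SG(4)[of x] by (simp add: \<gamma>p_def a\<delta>)
    qed (unfold \<gamma>p_def[abs_def] \<gamma>m_def[abs_def], (rule SG SH)+)
    then show "\<exists>\<gamma>p \<gamma>m. ?P \<epsilon> \<gamma>p \<gamma>m" by blast
  qed
next
  assume selections: "\<forall>\<epsilon>>0. \<exists>\<gamma>p \<gamma>m. ?P \<epsilon> \<gamma>p \<gamma>m"
  then show "approximately_conormal \<alpha> Xpos"
    unfolding approximately_conormal_def conormal_def by (meson rangeI subsetD)
qed

end
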